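(* For a polygonal 2-tree $G$, the set of induced cycles of $G$ is the unique minimum cycle basis of $G$.
   Context: All graphs are finite, simple, undirected and unweighted. A polygonal 2-tree is defined recursively: every cycle is a polygonal 2-tree; if $G$ is a polygonal 2-tree and $(u,v) \in E(G)$, then adding a new path $P$ between $u$ and $v$ with $E(G) \cap E(P) = \emptyset$, $V(G) \cap V(P) = \{u,v\}$ and $|E(P)| \geq 2$ yields a polygonal 2-tree. An induced cycle is a chordless cycle. A graph is Eulerian if every vertex has even degree. For subgraphs $H_1,\ldots,H_k$, $H_1 \oplus \cdots \oplus H_k$ is the graph consisting of the edges appearing in an odd number of the $H_i$. A cycle basis of $G$ is a minimal set $\mathcal{B}$ of Eulerian subgraphs of $G$ such that every cycle of $G$ is the $\oplus$-sum of a subset of $\mathcal{B}$. A minimum cycle basis is a cycle basis minimizing the total number of edges of its members. *)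

theory Defs
  imports Main
begin

datatype 'a graph = Graph (verts: "'a set") (edges: "'a set set")

definition simple_graph :: "'a graph \<Rightarrow> bool" where
  "simple_graph G \<longleftrightarrow> finite (verts G) \<and>
     (\<forall>e\<in>edges G. \<exists>u v. u \<in> verts G \<and> v \<in> verts G \<and> u \<noteq> v \<and> e = {u, v})"

definition subgraph :: "'a graph \<Rightarrow> 'a graph \<Rightarrow> bool" where
  "subgraph H G \<longleftrightarrow> simple_graph H \<and> verts H \<subseteq> verts G \<and> edges H \<subseteq> edges G"

definition graph_union :: "'a graph \<Rightarrow> 'a graph \<Rightarrow> 'a graph" where
  "graph_union G H = Graph (verts G \<union> verts H) (edges G \<union> edges H)"

definition consecutive_edges :: "'a list \<Rightarrow> 'a set set" where
  "consecutive_edges xs = {{xs ! i, xs ! Suc i} | i. Suc i < length xs}"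

definition path_between :: "'a graph \<Rightarrow> 'a \<Rightarrow> 'a \<Rightarrow> bool" where
  "path_between P u v \<longleftrightarrow> (\<exists>xs. xs \<noteq> [] \<and> distinct xs \<and> hd xs = u \<and> last xs = v \<and>
     P = Graph (set xs) (consecutive_edges xs))"

definition is_cycle :: "'a graph \<Rightarrow> bool" where
  "is_cycle C \<longleftrightarrow> (\<exists>xs. length xs \<ge> 3 \<and> distinct xs \<and>
     C = Graph (set xs) (insert {last xs, hd xs} (consecutive_edges xs)))"

inductive polygonal_2_tree :: "'a graph \<Rightarrow> bool" where
  cycle: "is_cycle G \<Longrightarrow> polygonal_2_tree G"
| add_path: "\<lbrakk>polygonal_2_tree G; {u, v} \<in> edges G; path_between P u v;
     edges G \<inter> edges P = {}; verts G \<inter> verts P = {u, v}; card (edges P) \<ge> 2\<rbrakk>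
     \<Longrightarrow> polygonal_2_tree (graph_union G P)"

definition induced_cycle :: "'a graph \<Rightarrow> 'a graph \<Rightarrow> bool" where
  "induced_cycle C G \<longleftrightarrow> is_cycle C \<and> subgraph C G \<and>
     (\<forall>e\<in>edges G. e \<subseteq> verts C \<longrightarrow> e \<in> edges C)"

definition degree :: "'a graph \<Rightarrow> 'a \<Rightarrow> nat" where
  "degree G v = card {e \<in> edges G. v \<in> e}"

definition eulerian :: "'a graph \<Rightarrow> bool" where
  "eulerian G \<longleftrightarrow> (\<forall>v\<in>verts G. even (degree G v))"

text \<open>
  The sum is the graph consisting of the edges that occur in an odd number of members, so its
  vertices are exactly the endpoints of these edges. It is meant for finite families.
\<close>

definition ring_sum :: "'a graph set \<Rightarrow> 'a graph" where
  "ring_sum S = (let F = {e. odd (card {H \<in> S. e \<in> edges H})} in Graph (\<Union>F) F)"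

text \<open>
  As usual for cycle spaces, Eulerian subgraphs are identified with their edge sets: isolated
  vertices are irrelevant to sums and to the number of edges. The condition
  \<open>verts H = \<Union>(edges H)\<close> selects the representative without isolated vertices; if they were
  allowed, adding one to a basis member would spoil any uniqueness claim.
\<close>

definition eulerian_subgraph :: "'a graph \<Rightarrow> 'a graph \<Rightarrow> bool" where
  "eulerian_subgraph H G \<longleftrightarrow> subgraph H G \<and> verts H = \<Union>(edges H) \<and> eulerian H"

definition generates_cycles :: "'a graph set \<Rightarrow> 'a graph \<Rightarrow> bool" where
  "generates_cycles B G \<longleftrightarrow>
     (\<forall>C. is_cycle C \<and> subgraph C G \<longrightarrow> (\<exists>S. S \<subseteq> B \<and> C = ring_sum S))"

definition cycle_basis :: "'a graph set \<Rightarrow> 'a graph \<Rightarrow> bool" where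
  "cycle_basis B G \<longleftrightarrow> (\<forall>H\<in>B. eulerian_subgraph H G) \<and> generates_cycles B G \<and>
     (\<forall>B'. B' \<subset> B \<longrightarrow> \<not> generates_cycles B' G)"

definition total_size :: "'a graph set \<Rightarrow> nat" where
  "total_size B = (\<Sum>H\<in>B. card (edges H))"

definition minimum_cycle_basis :: "'a graph set \<Rightarrow> 'a graph \<Rightarrow> bool" where
  "minimum_cycle_basis B G \<longleftrightarrow> cycle_basis B G \<and>
     (\<forall>B'. cycle_basis B' G \<longrightarrow> total_size B \<le> total_size B')"

lemma consecutive_edges_simple:
  assumes "distinct xs" "e \<in> consecutive_edges xs"
  shows "\<exists>u v. u \<in> set xs \<and> v \<in> set xs \<and> u \<noteq> v \<and> e = {u, v}"
proof -
  from assms(2) obtain i where i: "Suc i < length xs" "e = {xs ! i, xs ! Suc i}"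
    unfolding consecutive_edges_def by blast
  have "xs ! i \<noteq> xs ! Suc i"
    using i(1) assms(1) by (simp add: nth_eq_iff_index_eq)
  moreover have "xs ! i \<in> set xs" "xs ! Suc i \<in> set xs"
    using i(1) by simp_all
  ultimately show ?thesis using i(2) by (intro exI conjI)
qed

lemma is_cycle_simple_graph:
  assumes "is_cycle C"
  shows "simple_graph C"
proof -
  obtain xs where xs: "length xs \<ge> 3" "distinct xs"
      "C = Graph (set xs) (insert {last xs, hd xs} (consecutive_edges xs))"
    using assms unfolding is_cycle_def by blast
  have ne: "xs \<noteq> []" using xs(1) by force
  have "length xs - 1 < length xs" "0 < length xs" "length xs - 1 \<noteq> 0"
    using xs(1) by linarith+
  then have ne2: "last xs \<noteq> hd xs"
    using xs(2) unfolding last_conv_nth[OF ne] hd_conv_nth[OF ne] by (metis nth_eq_iff_index_eq)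
  have "\<exists>u v. u \<in> set xs \<and> v \<in> set xs \<and> u \<noteq> v \<and> e = {u, v}"
    if e: "e \<in> insert {last xs, hd xs} (consecutive_edges xs)" for e
  proof (cases "e = {last xs, hd xs}")
    case True
    with ne2 hd_in_set[OF ne] last_in_set[OF ne] show ?thesis by (intro exI conjI)
  next
    case False
    with e have "e \<in> consecutive_edges xs" by simp
    then show ?thesis by (rule consecutive_edges_simple[OF xs(2)])
  qed
  then show ?thesis
    unfolding xs(3) simple_graph_def graph.sel by (intro conjI ballI finite_set)
qed

lemma simple_graph_union:
  assumes "simple_graph G" "simple_graph H"
  shows "simple_graph (graph_union G H)"
  unfolding simple_graph_def graph_union_def graph.sel
proof (intro conjI ballI)
  show "finite (verts G \<union> verts H)"
    using assms by (simp add: simple_graph_def)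
next
  fix e assume "e \<in> edges G \<union> edges H"
  then have "(\<exists>u v. u \<in> verts G \<and> v \<in> verts G \<and> u \<noteq> v \<and> e = {u, v}) \<or>
      (\<exists>u v. u \<in> verts H \<and> v \<in> verts H \<and> u \<noteq> v \<and> e = {u, v})"
    using assms unfolding simple_graph_def by (elim UnE) simp_all
  then show "\<exists>u v. u \<in> verts G \<union> verts H \<and> v \<in> verts G \<union> verts H \<and> u \<noteq> v \<and> e = {u, v}"
    by (elim disjE, metis UnI1, metis UnI2)
qed

lemma path_between_simple_graph:
  assumes "path_between P u v"
  shows "simple_graph P"
proof -
  obtain xs where xs: "distinct xs" "P = Graph (set xs) (consecutive_edges xs)"
    using assms unfolding path_between_def by blast
  show ?thesis
    unfolding xs(2) simple_graph_def graph.sel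
    using consecutive_edges_simple[OF xs(1)] by (intro conjI ballI finite_set)
qed

lemma polygonal_2_tree_simple_graph: "polygonal_2_tree G \<Longrightarrow> simple_graph G"
  by (induction rule: polygonal_2_tree.induct)
    (blast intro: is_cycle_simple_graph simple_graph_union path_between_simple_graph)+

end

theory Submission imports Defs begin

text \<open>
  Adding an ear \<open>P\<close> at the edge \<open>uv\<close> adds exactly one induced cycle, namely \<open>P + uv\<close>. By induction
  on the ears, the induced cycles span all even edge sets, and a sum of two or more induced cycles
  has strictly more edges than each of its summands: the ear contributes at least two new edges
  and cancels at most one old edge. A Gaussian elimination argument shows that any spanning family
  can be matched injectively to the induced cycles so that each induced cycle occurs in the
  expansion of its partner, whence every other spanning family is strictly larger.
\<close>

section \<open>Parity and sums of edge sets\<close>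

lemma even_card_sym_diff_iff:
  assumes "finite A" "finite B"
  shows "even (card (sym_diff A B)) \<longleftrightarrow> (even (card A) \<longleftrightarrow> even (card B))"
proof -
  have "card (sym_diff A B) = card (A - B) + card (B - A)"
    using assms by (intro card_Un_disjoint) auto
  moreover have "card A = card (A - B) + card (A \<inter> B)"
    using assms by (subst card_Un_disjoint[symmetric]) (auto intro!: arg_cong[of _ _ card])
  moreover have "card B = card (B - A) + card (A \<inter> B)"
    using assms by (subst card_Un_disjoint[symmetric]) (auto intro!: arg_cong[of _ _ card])
  ultimately show ?thesis by auto
qed

lemma odd_sum_iff_odd_card:
  assumes "finite S"
  shows "odd (\<Sum>x\<in>S. g x :: nat) \<longleftrightarrow> odd (card {x \<in> S. odd (g x)})"
  using assms
proof (induction S rule: finite_induct)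
  case (insert a S)
  have "{x \<in> insert a S. odd (g x)} =
      (if odd (g a) then insert a {x \<in> S. odd (g x)} else {x \<in> S. odd (g x)})"
    by auto
  with insert show ?case by auto
qed simp

text \<open>Addition in the cycle space over GF(2), kept on bare edge sets; the vertices of
  \<open>ring_sum\<close> are recovered as endpoints.\<close>

definition edge_sum :: "'a graph set \<Rightarrow> 'a set set" where
  "edge_sum S = {e. odd (card {H \<in> S. e \<in> edges H})}"

lemma ring_sum_eq: "ring_sum S = Graph (\<Union>(edge_sum S)) (edge_sum S)"
  by (simp add: ring_sum_def edge_sum_def Let_def)

lemma edge_sum_empty [simp]: "edge_sum {} = {}"
  by (simp add: edge_sum_def)

lemma edge_sum_singleton [simp]: "edge_sum {C} = edges C"
proof -
  have "{H. H = C \<and> e \<in> edges H} = (if e \<in> edges C then {C} else {})" for e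
    by auto
  then show ?thesis by (auto simp: edge_sum_def)
qed

text \<open>Linearity modulo 2: a member common to both families is counted twice for each of its
  edges and so cancels.\<close>

lemma edge_sum_sym_diff:
  assumes "finite S" "finite T"
  shows "edge_sum (sym_diff S T) = sym_diff (edge_sum S) (edge_sum T)"
proof -
  have "{H \<in> sym_diff S T. e \<in> edges H} =
      sym_diff {H \<in> S. e \<in> edges H} {H \<in> T. e \<in> edges H}" for e
    by auto
  then show ?thesis
    using assms by (auto simp: edge_sum_def even_card_sym_diff_iff)
qed

lemma edge_sum_insert:
  assumes "finite S" "C \<notin> S"
  shows "edge_sum (insert C S) = sym_diff (edge_sum S) (edges C)"
proof -
  have "insert C S = sym_diff S {C}" using assms(2) by auto
  then show ?thesis using assms(1) by (simp add: edge_sum_sym_diff)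
qed

lemma edge_sum_subset:
  assumes "\<And>H. H \<in> S \<Longrightarrow> edges H \<subseteq> E"
  shows "edge_sum S \<subseteq> E"
proof
  fix e assume "e \<in> edge_sum S"
  then have "{H \<in> S. e \<in> edges H} \<noteq> {}"
    unfolding edge_sum_def by (metis (lifting) card.empty even_zero mem_Collect_eq)
  then show "e \<in> E" using assms by blast
qed

text \<open>Substitutes expansions into a sum: modulo 2, the coefficient of \<open>D\<close> is the
  number of \<open>H\<close> in \<open>S\<close> whose expansion uses \<open>D\<close>. For each
  fixed edge, the pairs of \<open>H\<close> and \<open>D\<close> are counted in both orders.\<close>

lemma edge_sum_of_sums:
  assumes "finite S" "finite I" "\<And>H. H \<in> S \<Longrightarrow> A H \<subseteq> I" "\<And>H. H \<in> S \<Longrightarrow> edge_sum (A H) = edges H"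
  shows "edge_sum S = edge_sum {D \<in> I. odd (card {H \<in> S. D \<in> A H})}"
proof (intro set_eqI)
  fix e
  let ?m = "\<lambda>H D. (if D \<in> A H \<and> e \<in> edges D then 1 else 0) :: nat"
  have "(\<Sum>D\<in>I. ?m H D) = card {D \<in> A H. e \<in> edges D}" if "H \<in> S" for H
  proof -
    have "{D \<in> A H. e \<in> edges D} = {D \<in> I. D \<in> A H \<and> e \<in> edges D}"
      using assms(3)[OF that] by auto
    then show ?thesis using assms(2) by (simp add: sum.If_cases Int_def)
  qed
  then have "e \<in> edges H \<longleftrightarrow> odd (\<Sum>D\<in>I. ?m H D)" if "H \<in> S" for H
    using assms(4)[OF that] that by (auto simp: edge_sum_def)
  then have "{H \<in> S. e \<in> edges H} = {H \<in> S. odd (\<Sum>D\<in>I. ?m H D)}"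
    by blast
  then have "e \<in> edge_sum S \<longleftrightarrow> odd (\<Sum>H\<in>S. \<Sum>D\<in>I. ?m H D)"
    using odd_sum_iff_odd_card[OF assms(1)] by (simp add: edge_sum_def)
  also have "(\<Sum>H\<in>S. \<Sum>D\<in>I. ?m H D) = (\<Sum>D\<in>I. \<Sum>H\<in>S. ?m H D)"
    by (rule sum.swap)
  also have "odd \<dots> \<longleftrightarrow> odd (card {D \<in> I. odd (\<Sum>H\<in>S. ?m H D)})"
    using odd_sum_iff_odd_card[OF assms(2)] .
  also have "{D \<in> I. odd (\<Sum>H\<in>S. ?m H D)} =
      {D \<in> {D \<in> I. odd (card {H \<in> S. D \<in> A H})}. e \<in> edges D}"
  proof -
    have "odd (\<Sum>H\<in>S. ?m H D) \<longleftrightarrow> odd (card {H \<in> S. D \<in> A H}) \<and> e \<in> edges D" for D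
      using assms(1) by (cases "e \<in> edges D") (simp_all add: sum.If_cases Int_def)
    then show ?thesis by auto
  qed
  finally show "e \<in> edge_sum S \<longleftrightarrow> e \<in> edge_sum {D \<in> I. odd (card {H \<in> S. D \<in> A H})}"
    by (simp add: edge_sum_def)
qed

text \<open>Membership in the cycle space without reference to a vertex set. Quantifying over every
  \<open>v\<close> is harmless, since a vertex on no edge of \<open>F\<close> counts zero
  edges.\<close>

definition even_edge_set :: "'a set set \<Rightarrow> bool" where
  "even_edge_set F \<longleftrightarrow> (\<forall>v. even (card {e \<in> F. v \<in> e}))"

lemma even_edge_set_sym_diff:
  assumes "finite E" "finite F" "even_edge_set E" "even_edge_set F"
  shows "even_edge_set (sym_diff E F)"
proof -
  have "{e \<in> sym_diff E F. v \<in> e} = sym_diff {e \<in> E. v \<in> e} {e \<in> F. v \<in> e}" for v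
    by auto
  with assms show ?thesis by (simp add: even_edge_set_def even_card_sym_diff_iff)
qed

text \<open>Meant for a vertex with only two candidate edges \<open>a\<close> and \<open>b\<close>:
  parity makes an even edge set contain both or neither.\<close>

lemma even_card_doubleton_inter_iff:
  assumes "a \<noteq> b" "even (card (H \<inter> {a, b}))"
  shows "a \<in> H \<longleftrightarrow> b \<in> H"
  using assms by (cases "a \<in> H"; cases "b \<in> H") simp_all

text \<open>
  If \<open>{i\<^sub>0}\<close> is the sum of the sets \<open>A j\<close> with \<open>j \<in> D\<close>, some \<open>A j\<^sub>0\<close> with \<open>j\<^sub>0 \<in> D\<close> contains
  \<open>i\<^sub>0\<close>; away from \<open>i\<^sub>0\<close> it is the sum of the others, so it can be dropped together with \<open>i\<^sub>0\<close>.
\<close>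

lemma spanning_family_transversal:
  assumes "finite I" "finite J"
    and "\<And>i. i \<in> I \<Longrightarrow> \<exists>D\<subseteq>J. \<forall>k\<in>I. odd (card {j \<in> D. k \<in> A j}) \<longleftrightarrow> k = i"
  shows "\<exists>f. inj_on f I \<and> f ` I \<subseteq> J \<and> (\<forall>i\<in>I. i \<in> A (f i))"
  using assms
proof (induction I arbitrary: J rule: finite_induct)
  case (insert i0 I)
  obtain D where D: "D \<subseteq> J" "\<forall>k\<in>insert i0 I. odd (card {j \<in> D. k \<in> A j}) \<longleftrightarrow> k = i0"
    using insert.prems(2)[of i0] by auto
  have "{j \<in> D. i0 \<in> A j} \<noteq> {}" using D(2) by (metis card.empty even_zero insertI1)
  then obtain j0 where j0: "j0 \<in> D" "i0 \<in> A j0" by blast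
  have "\<exists>E\<subseteq>J - {j0}. \<forall>k\<in>I. odd (card {j \<in> E. k \<in> A j}) \<longleftrightarrow> k = i" if i: "i \<in> I" for i
  proof -
    obtain E where E: "E \<subseteq> J" "\<forall>k\<in>insert i0 I. odd (card {j \<in> E. k \<in> A j}) \<longleftrightarrow> k = i"
      using insert.prems(2)[of i] i by auto
    show ?thesis
    proof (cases "j0 \<in> E")
      case False
      with E show ?thesis by (intro exI[of _ E]) auto
    next
      case True
      have fin: "finite D" "finite E"
        using D(1) E(1) insert.prems(1) finite_subset by blast+
      \<comment> \<open>\<open>j0\<close> lies in both \<open>E\<close> and \<open>D\<close>, so it
        drops out of \<open>sym_diff E D\<close>; adding \<open>D\<close> changes no coordinate in
        \<open>I\<close>, where the total over \<open>D\<close> is zero.\<close>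
      have "odd (card {j \<in> sym_diff E D. k \<in> A j}) \<longleftrightarrow> k = i" if k: "k \<in> I" for k
      proof -
        have "{j \<in> sym_diff E D. k \<in> A j} = sym_diff {j \<in> E. k \<in> A j} {j \<in> D. k \<in> A j}"
          by auto
        moreover have "k \<noteq> i0" using k insert.hyps by auto
        ultimately show ?thesis
          using k D(2) E(2) fin by (auto simp: even_card_sym_diff_iff)
      qed
      with True j0 D(1) E(1) show ?thesis
        by (intro exI[of _ "sym_diff E D"]) auto
    qed
  qed
  then obtain f where f: "inj_on f I" "f ` I \<subseteq> J - {j0}" "\<forall>i\<in>I. i \<in> A (f i)"
    using insert.IH[of "J - {j0}"] insert.prems(1) by auto
  let ?f = "f(i0 := j0)"
  have "inj_on ?f (insert i0 I)"
    using f insert.hyps(2) by (auto simp: inj_on_def)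
  moreover have "?f ` insert i0 I \<subseteq> J"
    using f(2) j0 D(1) by auto
  moreover have "\<forall>i\<in>insert i0 I. i \<in> A (?f i)"
    using f(3) j0 by auto
  ultimately show ?case by blast
qed simp

section \<open>Cycles\<close>

text \<open>Reduction modulo the length gives the closing edge the index
  \<open>length xs - 1\<close>, so a path and the cycle closing it share one indexing.\<close>

definition cyc_edge :: "'a list \<Rightarrow> nat \<Rightarrow> 'a set" where
  "cyc_edge xs i = {xs ! i, xs ! (Suc i mod length xs)}"

lemma consecutive_edges_eq_image:
  "consecutive_edges xs = cyc_edge xs ` {i. Suc i < length xs}"
  by (auto simp: consecutive_edges_def cyc_edge_def image_def)

lemma cycle_edges_eq_image:
  assumes "xs \<noteq> []"
  shows "insert {last xs, hd xs} (consecutive_edges xs) = cyc_edge xs ` {..<length xs}"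
proof -
  have "{last xs, hd xs} = cyc_edge xs (length xs - 1)"
    using assms by (simp add: cyc_edge_def last_conv_nth hd_conv_nth)
  moreover have "{..<length xs} = insert (length xs - 1) {i. Suc i < length xs}"
    using assms by auto
  ultimately show ?thesis by (simp add: consecutive_edges_eq_image)
qed

lemma Suc_mod_eq_iff:
  assumes "i < n" "j < n"
  shows "Suc i mod n = j \<longleftrightarrow> i = (if j = 0 then n - 1 else j - 1)"
  using assms by (cases "Suc i = n") auto

text \<open>Every vertex of a cycle has degree two: its edges carry its own index \<open>j\<close>
  and the cyclic predecessor \<open>p\<close>. Length at least 3 keeps these two edges
  apart.\<close>

lemma cyc_edges_at:
  assumes "distinct xs" "3 \<le> length xs" "j < length xs"
  defines "p \<equiv> if j = 0 then length xs - 1 else j - 1"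
  shows "{e \<in> cyc_edge xs ` {..<length xs}. xs ! j \<in> e} = {cyc_edge xs p, cyc_edge xs j}"
    and "cyc_edge xs p \<noteq> cyc_edge xs j"
proof -
  let ?n = "length xs"
  have p: "p < ?n" "Suc p mod ?n = j" "p \<noteq> j"
    using assms by (auto simp: p_def)
  have mem: "xs ! j \<in> cyc_edge xs i \<longleftrightarrow> i = j \<or> i = p" if "i < ?n" for i
  proof -
    have "Suc i mod ?n < ?n" using assms(3) by (intro mod_less_divisor) auto
    then have "xs ! j \<in> cyc_edge xs i \<longleftrightarrow> j = i \<or> j = Suc i mod ?n"
      using that assms(1,3) by (auto simp: cyc_edge_def nth_eq_iff_index_eq)
    then show ?thesis using Suc_mod_eq_iff[OF that assms(3)] unfolding p_def by auto
  qed
  show "{e \<in> cyc_edge xs ` {..<?n}. xs ! j \<in> e} = {cyc_edge xs p, cyc_edge xs j}"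
    using mem p(1) assms(3) by auto
  \<comment> \<open>The two edges are separated by the vertex after \<open>xs ! j\<close>, which
    lies on edge \<open>j\<close> but not on edge \<open>p\<close>.\<close>
  let ?s = "Suc j mod ?n"
  have s: "?s < ?n" using assms(3) by (intro mod_less_divisor) auto
  have "?s \<noteq> j" "?s \<noteq> p"
    using assms(2,3) by (cases "Suc j = ?n"; auto simp: p_def)+
  then have "xs ! ?s \<notin> cyc_edge xs p"
    using s p assms(1,3) by (auto simp: cyc_edge_def nth_eq_iff_index_eq)
  then show "cyc_edge xs p \<noteq> cyc_edge xs j"
    by (auto simp: cyc_edge_def)
qed

lemma is_cycleE:
  assumes "is_cycle C"
  obtains xs where "3 \<le> length xs" "distinct xs" "verts C = set xs"
    "edges C = cyc_edge xs ` {..<length xs}"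
proof -
  obtain xs where xs: "length xs \<ge> 3" "distinct xs"
      "C = Graph (set xs) (insert {last xs, hd xs} (consecutive_edges xs))"
    using assms unfolding is_cycle_def by blast
  then have "xs \<noteq> []" by auto
  with xs show ?thesis by (intro that[of xs]) (simp_all add: cycle_edges_eq_image)
qed

lemma is_cycle_even_edge_set:
  assumes "is_cycle C"
  shows "even_edge_set (edges C)"
  unfolding even_edge_set_def
proof
  fix v
  obtain xs where xs: "3 \<le> length xs" "distinct xs" "verts C = set xs"
      "edges C = cyc_edge xs ` {..<length xs}"
    using assms by (rule is_cycleE)
  show "even (card {e \<in> edges C. v \<in> e})"
  proof (cases "v \<in> set xs")
    case True
    then obtain j where "j < length xs" "v = xs ! j" by (auto simp: in_set_conv_nth)
    then show ?thesis using cyc_edges_at[OF xs(2,1)] xs(4) by simp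
  next
    case False
    have "e \<subseteq> verts C" if "e \<in> edges C" for e
      using is_cycle_simple_graph[OF assms] that by (auto simp: simple_graph_def)
    with False xs(3) have "{e \<in> edges C. v \<in> e} = {}" by auto
    then show ?thesis by (simp only: card.empty even_zero)
  qed
qed

lemma is_cycle_verts:
  assumes "is_cycle C"
  shows "verts C = \<Union>(edges C)"
proof -
  obtain xs where xs: "3 \<le> length xs" "distinct xs" "verts C = set xs"
      "edges C = cyc_edge xs ` {..<length xs}"
    using assms by (rule is_cycleE)
  have "set xs \<subseteq> \<Union>(edges C)"
    unfolding xs(4) by (fastforce simp: cyc_edge_def in_set_conv_nth)
  moreover have "\<Union>(edges C) \<subseteq> verts C"
    using is_cycle_simple_graph[OF assms] by (auto simp: simple_graph_def)
  ultimately show ?thesis using xs(3) by auto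
qed

text \<open>The edges with indices 0, 1 and 2 are distinct. The bound 3 is what later makes a sum
  involving an ear strictly larger than the new cycle.\<close>

lemma is_cycle_card_edges:
  assumes "is_cycle C"
  shows "3 \<le> card (edges C)"
proof -
  obtain xs where xs: "3 \<le> length xs" "distinct xs" "verts C = set xs"
      "edges C = cyc_edge xs ` {..<length xs}"
    using assms by (rule is_cycleE)
  let ?c = "cyc_edge xs"
  have "?c 0 \<noteq> ?c 1" "?c 1 \<noteq> ?c 2"
    using cyc_edges_at(2)[OF xs(2,1), of 1] cyc_edges_at(2)[OF xs(2,1), of 2] xs(1) by simp_all
  \<comment> \<open>Edges 0 and 2 need not be adjacent, so vertex 2 is used to tell them
    apart.\<close>
  moreover have "xs ! 2 \<noteq> xs ! 0" "xs ! 2 \<noteq> xs ! 1"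
    using xs(1) nth_eq_iff_index_eq[OF xs(2), of 2 0] nth_eq_iff_index_eq[OF xs(2), of 2 1]
    by force+
  then have "xs ! 2 \<notin> ?c 0" using xs(1) by (simp add: cyc_edge_def)
  then have "?c 0 \<noteq> ?c 2" by (auto simp: cyc_edge_def)
  ultimately have "card {?c 0, ?c 1, ?c 2} = 3" by simp
  moreover have "{?c 0, ?c 1, ?c 2} \<subseteq> edges C"
    using xs(1,4) by auto
  ultimately show ?thesis using xs(4) by (metis card_mono finite_imageI finite_lessThan)
qed

lemma even_edge_set_constant_on_path:
  assumes "distinct xs" "3 \<le> length xs"
    and "even_edge_set H"
    and inner: "\<And>j. 0 < j \<Longrightarrow> Suc j < length xs \<Longrightarrow>
      {e \<in> H. xs ! j \<in> e} \<subseteq> cyc_edge xs ` {..<length xs}"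
  shows "H \<inter> consecutive_edges xs = {} \<or> consecutive_edges xs \<subseteq> H"
proof -
  let ?c = "cyc_edge xs"
  have step: "?c i \<in> H \<longleftrightarrow> ?c (Suc i) \<in> H" if "Suc (Suc i) < length xs" for i
  proof -
    have "{e \<in> H. xs ! Suc i \<in> e} = H \<inter> {e \<in> ?c ` {..<length xs}. xs ! Suc i \<in> e}"
      using inner[of "Suc i"] that by auto
    also have "\<dots> = H \<inter> {?c i, ?c (Suc i)}"
      using cyc_edges_at(1)[OF assms(1,2), of "Suc i"] that by simp
    finally have "even (card (H \<inter> {?c i, ?c (Suc i)}))"
      using assms(3) unfolding even_edge_set_def by metis
    moreover have "?c i \<noteq> ?c (Suc i)"
      using cyc_edges_at(2)[OF assms(1,2), of "Suc i"] that by simp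
    ultimately show ?thesis by (metis even_card_doubleton_inter_iff)
  qed
  have "Suc i < length xs \<Longrightarrow> ?c i \<in> H \<longleftrightarrow> ?c 0 \<in> H" for i
    by (induction i) (use step in auto)
  then show ?thesis unfolding consecutive_edges_eq_image by blast
qed

text \<open>Parity at inner vertices ties the path edges together, and parity at the first vertex
  ties the closing edge to them. Thus cycles are minimal among the nonempty even edge sets.\<close>

lemma even_edge_set_subset_cycle:
  assumes "is_cycle C" "H \<subseteq> edges C" "even_edge_set H"
  shows "H = {} \<or> H = edges C"
proof -
  obtain xs where xs: "length xs \<ge> 3" "distinct xs"
      "C = Graph (set xs) (insert {last xs, hd xs} (consecutive_edges xs))"
    using assms unfolding is_cycle_def by blast
  have ne: "xs \<noteq> []" using xs(1) by auto
  let ?c = "cyc_edge xs" and ?n = "length xs"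
  have C: "edges C = ?c ` {..<?n}" using xs(3) cycle_edges_eq_image[OF ne] by simp
  have "{e \<in> H. xs ! 0 \<in> e} = H \<inter> {e \<in> ?c ` {..<?n}. xs ! 0 \<in> e}"
    using assms(2) C by auto
  also have "\<dots> = H \<inter> {?c (?n - 1), ?c 0}"
    using cyc_edges_at(1)[OF xs(2,1), of 0] ne by simp
  finally have "even (card (H \<inter> {?c (?n - 1), ?c 0}))"
    using assms(3) unfolding even_edge_set_def by metis
  moreover have "?c (?n - 1) \<noteq> ?c 0"
    using cyc_edges_at(2)[OF xs(2,1), of 0] ne by simp
  ultimately have "?c (?n - 1) \<in> H \<longleftrightarrow> ?c 0 \<in> H"
    by (metis even_card_doubleton_inter_iff)
  moreover have "?c (?n - 1) = {last xs, hd xs}"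
    using ne by (simp add: cyc_edge_def last_conv_nth hd_conv_nth)
  moreover have "?c 0 \<in> consecutive_edges xs"
    using xs(1) by (auto simp: consecutive_edges_eq_image)
  moreover have "H \<inter> consecutive_edges xs = {} \<or> consecutive_edges xs \<subseteq> H"
    using assms(2,3) C xs(1,2) by (intro even_edge_set_constant_on_path) auto
  ultimately show ?thesis using assms(2) xs(3) by auto
qed

text \<open>Minimality of cycles among nonempty even edge sets equates the edges, and the edges
  determine the vertices.\<close>

lemma cycle_eqI:
  assumes "is_cycle C" "is_cycle D" "edges C \<subseteq> edges D"
  shows "C = D"
proof -
  have "edges C \<noteq> {}" using is_cycle_card_edges[OF assms(1)] by auto
  then have "edges C = edges D"
    using even_edge_set_subset_cycle[OF assms(2,3)] is_cycle_even_edge_set[OF assms(1)] by auto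
  then show ?thesis
    using is_cycle_verts[OF assms(1)] is_cycle_verts[OF assms(2)] by (simp add: graph.expand)
qed

section \<open>Induced cycles under the addition of an ear\<close>

lemma simple_graph_finite_edges:
  assumes "simple_graph G"
  shows "finite (edges G)"
proof -
  have "edges G \<subseteq> Pow (verts G)" using assms by (auto simp: simple_graph_def)
  then show ?thesis using assms by (auto simp: simple_graph_def intro: finite_subset)
qed

lemma simple_graph_edge_subset: "simple_graph G \<Longrightarrow> e \<in> edges G \<Longrightarrow> e \<subseteq> verts G"
  by (auto simp: simple_graph_def)

lemma induced_cycles_of_cycle:
  assumes "is_cycle G"
  shows "{C. induced_cycle C G} = {G}"
  using assms cycle_eqI
  by (auto simp: induced_cycle_def subgraph_def is_cycle_simple_graph)

text \<open>The setting of \<open>add_path\<close>, with the ear given by its vertex list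
  \<open>xs\<close>; of \<open>G\<close> itself only simplicity is asked.\<close>

locale ear =
  fixes G :: "'a graph" and u v :: 'a and xs :: "'a list"
  assumes simple: "simple_graph G"
    and uv: "{u, v} \<in> edges G"
    and xs: "distinct xs" "xs \<noteq> []" "hd xs = u" "last xs = v"
    and edges_disjoint: "edges G \<inter> consecutive_edges xs = {}"
    and verts_inter: "verts G \<inter> set xs = {u, v}"
    and card_ear: "2 \<le> card (consecutive_edges xs)"
begin

abbreviation G' :: "'a graph" where
  "G' \<equiv> graph_union G (Graph (set xs) (consecutive_edges xs))"

text \<open>The ear closed by its base edge: the one induced cycle that the ear creates.\<close>

definition C0 :: "'a graph" where
  "C0 = Graph (set xs) (insert {u, v} (consecutive_edges xs))"

lemma length_xs: "3 \<le> length xs"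
proof -
  have "{i. Suc i < length xs} = {..<length xs - 1}" by auto
  then have "card (consecutive_edges xs) \<le> length xs - 1"
    unfolding consecutive_edges_eq_image using card_image_le[of "{..<length xs - 1}"] by simp
  then show ?thesis using card_ear by linarith
qed

lemma cycle_C0: "is_cycle C0"
  unfolding is_cycle_def C0_def using length_xs xs by (auto simp: insert_commute)

lemma edges_C0: "edges C0 = insert {u, v} (consecutive_edges xs)"
  by (simp add: C0_def)

lemma edges_G': "edges G' = edges G \<union> consecutive_edges xs"
  and verts_G': "verts G' = verts G \<union> set xs"
  by (simp_all add: graph_union_def)

lemma simple_G': "simple_graph G'"
  using consecutive_edges_simple[OF xs(1)] simple
  by (intro simple_graph_union) (auto simp: simple_graph_def)

text \<open>Inner vertices of the ear lie outside \<open>G\<close>, so only ear edges meet them, and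
  parity forces all ear edges into \<open>H\<close> or none.\<close>

lemma even_edge_set_cases:
  assumes "H \<subseteq> edges G'" "even_edge_set H"
  obtains "H \<subseteq> edges G" | "consecutive_edges xs \<subseteq> H"
proof -
  have "{e \<in> H. xs ! j \<in> e} \<subseteq> cyc_edge xs ` {..<length xs}"
    if j: "0 < j" "Suc j < length xs" for j
  proof -
    have "u = xs ! 0" "v = xs ! (length xs - 1)"
      using hd_conv_nth[OF xs(2)] last_conv_nth[OF xs(2)] xs(3,4) by simp_all
    moreover have "xs ! j \<noteq> xs ! 0"
      using j by (subst nth_eq_iff_index_eq[OF xs(1)]) linarith+
    moreover have "xs ! j \<noteq> xs ! (length xs - 1)"
      using j by (subst nth_eq_iff_index_eq[OF xs(1)]) linarith+
    ultimately have "xs ! j \<noteq> u" "xs ! j \<noteq> v"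
      by simp_all
    moreover have "xs ! j \<in> set xs" using j by simp
    ultimately have "xs ! j \<notin> verts G" using verts_inter by blast
    then have "xs ! j \<notin> e" if "e \<in> edges G" for e
      using simple_graph_edge_subset[OF simple that] by blast
    then have "{e \<in> H. xs ! j \<in> e} \<subseteq> consecutive_edges xs"
      using assms(1) edges_G' by auto
    then show ?thesis by (auto simp: consecutive_edges_eq_image)
  qed
  then have "H \<inter> consecutive_edges xs = {} \<or> consecutive_edges xs \<subseteq> H"
    using even_edge_set_constant_on_path[OF xs(1) length_xs assms(2)] by blast
  then show ?thesis using that assms(1) edges_G' by blast
qed

lemma not_induced_C0: "\<not> induced_cycle C0 G"
proof
  assume "induced_cycle C0 G"
  then have "consecutive_edges xs \<subseteq> edges G"
    by (auto simp: induced_cycle_def subgraph_def edges_C0)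
  then show False using edges_disjoint card_ear by (auto simp: Int_absorb1)
qed

text \<open>An ear edge inside \<open>verts G\<close> would join \<open>u\<close> and
  \<open>v\<close>, but that edge already belongs to \<open>G\<close>. Hence the ear gives no chord
  to a cycle of \<open>G\<close>.\<close>

lemma ear_edge_not_in_G:
  assumes "e \<in> consecutive_edges xs"
  shows "\<not> e \<subseteq> verts G"
proof
  assume sub: "e \<subseteq> verts G"
  obtain a b where "a \<noteq> b" "e = {a, b}" "e \<subseteq> set xs"
    using consecutive_edges_simple[OF xs(1) assms] by auto
  moreover from this sub verts_inter have "e \<subseteq> {u, v}" by blast
  ultimately have "e = {u, v}" by auto
  then show False using uv edges_disjoint assms by auto
qed

text \<open>Rules out chords of \<open>C0\<close> coming from \<open>G\<close>.\<close>

lemma G_edge_in_ear: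
  assumes "e \<in> edges G" "e \<subseteq> set xs"
  shows "e = {u, v}"
proof -
  obtain a b where "a \<noteq> b" "e = {a, b}" "e \<subseteq> verts G"
    using simple assms(1) unfolding simple_graph_def by auto
  moreover from this assms(2) verts_inter have "e \<subseteq> {u, v}" by blast
  ultimately show ?thesis by auto
qed

text \<open>A chordless cycle using the ear passes through \<open>u\<close> and \<open>v\<close>, so
  it contains \<open>{u, v}\<close>, hence all of \<open>C0\<close>, and equals it by minimality.
  Conversely, neither \<open>C0\<close> nor an induced cycle of \<open>G\<close> has a chord in
  \<open>G'\<close>.\<close>

lemma induced_cycles_G': "{C. induced_cycle C G'} = insert C0 {C. induced_cycle C G}"
proof (intro equalityI subsetI)
  fix C assume "C \<in> {C. induced_cycle C G'}"
  then have C: "is_cycle C" "subgraph C G'" "\<And>e. e \<in> edges G' \<Longrightarrow> e \<subseteq> verts C \<Longrightarrow> e \<in> edges C"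
    by (auto simp: induced_cycle_def)
  have sub: "edges C \<subseteq> edges G'" using C(2) by (simp add: subgraph_def)
  show "C \<in> insert C0 {C. induced_cycle C G}"
    using sub is_cycle_even_edge_set[OF C(1)]
  proof (cases rule: even_edge_set_cases)
    case 1
    then have "verts C \<subseteq> verts G"
      using is_cycle_verts[OF C(1)] simple_graph_edge_subset[OF simple] by auto
    with 1 C have "induced_cycle C G"
      by (auto simp: induced_cycle_def subgraph_def edges_G')
    then show ?thesis by simp
  next
    case 2
    have "u \<in> \<Union>(consecutive_edges xs)" "v \<in> \<Union>(consecutive_edges xs)"
    proof -
      have "{xs ! 0, xs ! Suc 0} \<in> consecutive_edges xs"
        using length_xs by (auto simp: consecutive_edges_def)
      then show "u \<in> \<Union>(consecutive_edges xs)"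
        using xs by (auto simp: hd_conv_nth)
      \<comment> \<open>The last ear edge starts one place before \<open>v\<close>, which stands at
        index \<open>length xs - 1\<close>.\<close>
      have "{xs ! (length xs - 2), xs ! Suc (length xs - 2)} \<in> consecutive_edges xs"
        using length_xs unfolding consecutive_edges_def
        by (intro CollectI exI[of _ "length xs - 2"]) auto
      moreover have "Suc (length xs - 2) = length xs - 1" using length_xs by auto
      ultimately show "v \<in> \<Union>(consecutive_edges xs)"
        using xs by (auto simp: last_conv_nth)
    qed
    with 2 have "{u, v} \<subseteq> verts C" using is_cycle_verts[OF C(1)] by blast
    then have "{u, v} \<in> edges C" using C(3) uv edges_G' by blast
    with 2 have "edges C0 \<subseteq> edges C" by (simp add: edges_C0)
    then show ?thesis using cycle_eqI[OF cycle_C0 C(1)] by simp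
  qed
next
  fix C assume "C \<in> insert C0 {C. induced_cycle C G}"
  then consider "C = C0" | "induced_cycle C G" by auto
  then show "C \<in> {C. induced_cycle C G'}"
  proof cases
    case 1
    have "subgraph C0 G'"
      using is_cycle_simple_graph[OF cycle_C0] uv
      by (auto simp: subgraph_def C0_def graph_union_def)
    moreover have "\<forall>e\<in>edges G'. e \<subseteq> verts C0 \<longrightarrow> e \<in> edges C0"
      using G_edge_in_ear by (auto simp: edges_G' C0_def)
    ultimately show ?thesis using 1 cycle_C0 by (simp add: induced_cycle_def)
  next
    case 2
    then have "verts C \<subseteq> verts G" by (simp add: induced_cycle_def subgraph_def)
    then have "e \<in> edges G" if "e \<in> edges G'" "e \<subseteq> verts C" for e
      using that ear_edge_not_in_G edges_G' by blast
    with 2 show ?thesis by (auto simp: induced_cycle_def subgraph_def edges_G' verts_G')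
  qed
qed

end

section \<open>Expansions in induced cycles and the sizes of their sums\<close>

lemma induced_cycle_edges_subset: "induced_cycle C G \<Longrightarrow> edges C \<subseteq> edges G"
  by (simp add: induced_cycle_def subgraph_def)

definition spanned_by_induced_cycles :: "'a graph \<Rightarrow> bool" where
  "spanned_by_induced_cycles G \<longleftrightarrow>
     (\<forall>F\<subseteq>edges G. even_edge_set F \<longrightarrow> (\<exists>S\<subseteq>{C. induced_cycle C G}. edge_sum S = F))"

text \<open>Encodes linear independence as well: a nonempty family with empty sum would have to be a
  singleton, and cycles have edges.\<close>

definition sums_exceed_summands :: "'a graph \<Rightarrow> bool" where
  "sums_exceed_summands G \<longleftrightarrow>
     (\<forall>S\<subseteq>{C. induced_cycle C G}. \<forall>C\<in>S. S = {C} \<or> card (edges C) < card (edge_sum S))"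

lemma induced_cycle_eulerian_subgraph:
  assumes "induced_cycle C G"
  shows "eulerian_subgraph C G"
proof -
  have "is_cycle C" "subgraph C G" using assms by (auto simp: induced_cycle_def)
  then show ?thesis
    using is_cycle_verts is_cycle_even_edge_set
    by (auto simp: eulerian_subgraph_def eulerian_def degree_def even_edge_set_def)
qed

text \<open>Without isolated vertices such a subgraph is determined by its edge set, a subset of the
  finite set \<open>edges G\<close>.\<close>

lemma finite_eulerian_subgraphs:
  assumes "simple_graph G" "\<forall>H\<in>B. eulerian_subgraph H G"
  shows "finite B"
proof -
  have "inj_on edges B"
    using assms(2) by (intro inj_onI) (simp add: eulerian_subgraph_def graph.expand)
  moreover have "edges ` B \<subseteq> Pow (edges G)"
    using assms(2) by (auto simp: eulerian_subgraph_def subgraph_def)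
  ultimately show ?thesis
    using simple_graph_finite_edges[OF assms(1)] by (meson finite_Pow_iff inj_on_finite)
qed

lemma finite_induced_cycles: "simple_graph G \<Longrightarrow> finite {C. induced_cycle C G}"
  using finite_eulerian_subgraphs[of G "{C. induced_cycle C G}"] induced_cycle_eulerian_subgraph
  by auto

context ear
begin

text \<open>An even set containing the whole ear becomes an even set of \<open>G\<close> when
  \<open>C0\<close> is added; inserting \<open>C0\<close> into the expansion of the latter undoes
  this.\<close>

lemma spanned_G':
  assumes "spanned_by_induced_cycles G"
  shows "spanned_by_induced_cycles G'"
  unfolding spanned_by_induced_cycles_def
proof (intro allI impI)
  fix F assume F: "F \<subseteq> edges G'" "even_edge_set F"
  then show "\<exists>S\<subseteq>{C. induced_cycle C G'}. edge_sum S = F"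
  proof (cases rule: even_edge_set_cases)
    case 1
    with F(2) assms show ?thesis
      unfolding spanned_by_induced_cycles_def induced_cycles_G' by blast
  next
    case 2
    let ?F = "sym_diff F (edges C0)"
    have "finite F" "finite (edges C0)"
      using F(1) simple_graph_finite_edges simple_G' is_cycle_simple_graph[OF cycle_C0]
        finite_subset by blast+
    then have "even_edge_set ?F"
      using F(2) is_cycle_even_edge_set[OF cycle_C0] by (intro even_edge_set_sym_diff)
    \<comment> \<open>All ear edges cancel, and the toggled edge \<open>{u, v}\<close> belongs to
      \<open>G\<close>.\<close>
    moreover have "?F \<subseteq> edges G" using 2 F(1) uv by (auto simp: edges_C0 edges_G')
    ultimately obtain S where S: "S \<subseteq> {C. induced_cycle C G}" "edge_sum S = ?F"
      using assms[unfolded spanned_by_induced_cycles_def, rule_format, of ?F] by metis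
    then have "finite S" "C0 \<notin> S"
      using finite_induced_cycles[OF simple] finite_subset not_induced_C0 by auto
    then have "edge_sum (insert C0 S) = sym_diff ?F (edges C0)"
      using S(2) by (simp add: edge_sum_insert)
    also have "\<dots> = F" by auto
    finally show ?thesis using S(1) unfolding induced_cycles_G' by blast
  qed
qed

text \<open>If \<open>C0\<close> takes part, the sum over the remaining family \<open>T\<close> lies
  in \<open>G\<close>, so every ear edge survives and only \<open>{u, v}\<close> can cancel.\<close>

lemma sums_exceed_G':
  assumes "sums_exceed_summands G"
  shows "sums_exceed_summands G'"
  unfolding sums_exceed_summands_def
proof (intro allI impI ballI)
  fix S C assume S: "S \<subseteq> {C. induced_cycle C G'}" and C: "C \<in> S"
  show "S = {C} \<or> card (edges C) < card (edge_sum S)"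
  proof (cases "C0 \<in> S")
    case False
    then have "S \<subseteq> {C. induced_cycle C G}" using S induced_cycles_G' by auto
    then show ?thesis using assms C unfolding sums_exceed_summands_def by blast
  next
    case True
    define T where "T = S - {C0}"
    let ?P = "consecutive_edges xs"
    have T: "T \<subseteq> {C. induced_cycle C G}" "S = insert C0 T" "C0 \<notin> T"
      using S True induced_cycles_G' by (auto simp: T_def)
    have "finite T" using T(1) finite_induced_cycles[OF simple] finite_subset by blast
    have sub: "edge_sum T \<subseteq> edges G"
      using T(1) induced_cycle_edges_subset by (intro edge_sum_subset) auto
    then have fin: "finite (edge_sum T)"
      using simple_graph_finite_edges[OF simple] finite_subset by blast
    have finP: "finite ?P" using card_ear by (intro card_ge_0_finite) simp
    have "edge_sum S = sym_diff (edge_sum T) {{u, v}} \<union> ?P"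
      using T \<open>finite T\<close> sub edges_disjoint uv by (auto simp: edge_sum_insert edges_C0)
    moreover have "sym_diff (edge_sum T) {{u, v}} \<inter> ?P = {}"
      using sub edges_disjoint uv by auto
    ultimately have card_S: "card (edge_sum S) = card (sym_diff (edge_sum T) {{u, v}}) + card ?P"
      using fin finP by (simp add: card_Un_disjoint)
    have "card (edge_sum T - {{u, v}}) \<le> card (sym_diff (edge_sum T) {{u, v}})"
      using fin by (intro card_mono) auto
    \<comment> \<open>The subtracted 1 pays for \<open>{u, v}\<close>, which is lost when it occurs
      in the sum over \<open>T\<close>.\<close>
    then have bound: "card (edge_sum T) - 1 + card ?P \<le> card (edge_sum S)"
      using card_S diff_card_le_card_Diff[of "{{u, v}}" "edge_sum T"] by simp
    have exceed: "card (edges D) \<le> card (edge_sum T)" if "D \<in> T" for D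
    proof -
      have "T = {D} \<or> card (edges D) < card (edge_sum T)"
        using assms T(1) that unfolding sums_exceed_summands_def by blast
      then show ?thesis by auto
    qed
    show ?thesis
    proof (cases "T = {}")
      case True
      then show ?thesis using C T(2) by auto
    next
      case False
      then obtain D where D: "D \<in> T" by auto
      then have "3 \<le> card (edges D)"
        using T(1) is_cycle_card_edges by (auto simp: induced_cycle_def)
      with exceed[OF D] have ge3: "3 \<le> card (edge_sum T)" by simp
      have "card (edges C) < card (edge_sum S)"
      proof (cases "C = C0")
        case True
        \<comment> \<open>\<open>C0\<close> has at most one edge more than the ear, while the sum
          has at least two edges besides the ear.\<close>
        have "card (edges C) \<le> Suc (card ?P)"
          using finP True by (simp add: edges_C0 card_insert_if)
        then show ?thesis using bound ge3 by linarith
      next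
        case False
        then have "card (edges C) \<le> card (edge_sum T)" using exceed C T(2) by auto
        then show ?thesis using bound ge3 card_ear by linarith
      qed
      then show ?thesis ..
    qed
  qed
qed

end

text \<open>In a single cycle the only even edge sets are the empty and the full one, and the only
  nonempty family of induced cycles is a singleton. The locale \<open>ear\<close> supplies the
  induction step.\<close>

lemma polygonal_2_tree_induced_cycles:
  assumes "polygonal_2_tree G"
  shows "spanned_by_induced_cycles G \<and> sums_exceed_summands G"
  using assms
proof (induction rule: polygonal_2_tree.induct)
  case (cycle G)
  note I = induced_cycles_of_cycle[OF cycle]
  have "\<exists>S\<subseteq>{G}. edge_sum S = F" if "F \<subseteq> edges G" "even_edge_set F" for F
    using even_edge_set_subset_cycle[OF cycle that]
    by (metis bot.extremum edge_sum_empty edge_sum_singleton order_refl)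
  then show ?case
    by (auto simp: spanned_by_induced_cycles_def sums_exceed_summands_def I subset_singleton_iff)
next
  case (add_path G u v P)
  obtain xs where path: "xs \<noteq> []" "distinct xs" "hd xs = u" "last xs = v"
      "P = Graph (set xs) (consecutive_edges xs)"
    using add_path.hyps(3) unfolding path_between_def by blast
  interpret ear G u v xs
    using add_path.hyps path by unfold_locales (auto intro: polygonal_2_tree_simple_graph)
  show ?case using add_path.IH spanned_G' sums_exceed_G' path(5) by simp
qed

section \<open>Cycle bases\<close>

lemma eulerian_subgraph_even_edge_set:
  assumes "eulerian_subgraph H G"
  shows "even_edge_set (edges H)"
  unfolding even_edge_set_def
proof
  fix v
  show "even (card {e \<in> edges H. v \<in> e})"
  proof (cases "v \<in> verts H")
    case True
    then show ?thesis using assms by (auto simp: eulerian_subgraph_def eulerian_def degree_def)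
  next
    case False
    then have "{e \<in> edges H. v \<in> e} = {}" using assms by (auto simp: eulerian_subgraph_def)
    then show ?thesis by (simp only: card.empty even_zero)
  qed
qed

text \<open>Linear independence: two distinct expansions of one edge set would differ by a nonempty
  family with empty sum.\<close>

lemma edge_sum_induced_cycles_inj:
  assumes "simple_graph G" "sums_exceed_summands G"
    and "S \<subseteq> {C. induced_cycle C G}" "T \<subseteq> {C. induced_cycle C G}" "edge_sum S = edge_sum T"
  shows "S = T"
proof (rule ccontr)
  assume "S \<noteq> T"
  then obtain C where C: "C \<in> sym_diff S T" by auto
  have "finite S" "finite T"
    using assms(3,4) finite_induced_cycles[OF assms(1)] finite_subset by blast+
  then have zero: "edge_sum (sym_diff S T) = {}"
    using assms(5) by (simp add: edge_sum_sym_diff)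
  have "sym_diff S T \<subseteq> {C. induced_cycle C G}" using assms(3,4) by auto
  then have "sym_diff S T = {C} \<or> card (edges C) < card (edge_sum (sym_diff S T))"
    using assms(2) C unfolding sums_exceed_summands_def by blast
  with zero have "edge_sum {C} = {}" by (metis card.empty not_less0)
  moreover have "is_cycle C" using C assms(3,4) by (auto simp: induced_cycle_def)
  ultimately show False using is_cycle_card_edges[of C] by simp
qed

lemma induced_cycles_generate:
  assumes "spanned_by_induced_cycles G"
  shows "generates_cycles {C. induced_cycle C G} G"
  unfolding generates_cycles_def
proof (intro allI impI)
  fix C assume C: "is_cycle C \<and> subgraph C G"
  then obtain S where "S \<subseteq> {C. induced_cycle C G}" "edge_sum S = edges C"
    using assms is_cycle_even_edge_set unfolding spanned_by_induced_cycles_def subgraph_def by metis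
  moreover from this have "C = ring_sum S"
    using C is_cycle_verts[of C] by (simp add: ring_sum_eq graph.expand)
  ultimately show "\<exists>S\<subseteq>{C. induced_cycle C G}. C = ring_sum S" by blast
qed

text \<open>By independence an induced cycle has no expansion but itself alone, so leaving it out
  destroys generation.\<close>

lemma induced_cycles_cycle_basis:
  assumes "simple_graph G" "spanned_by_induced_cycles G" "sums_exceed_summands G"
  shows "cycle_basis {C. induced_cycle C G} G"
proof -
  have "\<not> generates_cycles B G" if B: "B \<subset> {C. induced_cycle C G}" for B
  proof
    assume "generates_cycles B G"
    moreover obtain C where C: "induced_cycle C G" "C \<notin> B" using B by auto
    ultimately obtain S where S: "S \<subseteq> B" "C = ring_sum S"
      unfolding generates_cycles_def induced_cycle_def by blast
    then have "edge_sum S = edge_sum {C}" by (simp add: ring_sum_eq)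
    then have "S = {C}"
      using edge_sum_induced_cycles_inj[OF assms(1,3), of S "{C}"] S(1) B C(1) by auto
    with S(1) C(2) show False by simp
  qed
  then show ?thesis
    unfolding cycle_basis_def
    using induced_cycles_generate[OF assms(2)] induced_cycle_eulerian_subgraph by blast
qed

text \<open>Each member of \<open>B\<close> is expanded in induced cycles by \<open>A\<close>. As
  \<open>B\<close> generates, the transversal lemma assigns to each \<open>C\<close> its own member
  \<open>f C\<close> whose expansion contains \<open>C\<close>; if that expansion is not
  \<open>C\<close> alone, \<open>f C\<close> is strictly larger.\<close>

lemma cycle_basis_transversal:
  assumes "simple_graph G" "spanned_by_induced_cycles G" "sums_exceed_summands G"
    and B: "cycle_basis B G"
  obtains f where "inj_on f {C. induced_cycle C G}" "f ` {C. induced_cycle C G} \<subseteq> B"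
    "\<And>C. induced_cycle C G \<Longrightarrow> f C = C \<or> card (edges C) < card (edges (f C))"
proof -
  let ?I = "{C. induced_cycle C G}"
  have eul: "\<And>H. H \<in> B \<Longrightarrow> eulerian_subgraph H G" and gen: "generates_cycles B G"
    using B by (auto simp: cycle_basis_def)
  have finB: "finite B" using finite_eulerian_subgraphs[OF assms(1)] eul by blast
  have finI: "finite ?I" using finite_induced_cycles[OF assms(1)] .
  have "\<forall>H\<in>B. \<exists>S\<subseteq>?I. edge_sum S = edges H"
    using assms(2) eul eulerian_subgraph_even_edge_set
    unfolding spanned_by_induced_cycles_def eulerian_subgraph_def subgraph_def by metis
  then obtain A where A: "\<And>H. H \<in> B \<Longrightarrow> A H \<subseteq> ?I" "\<And>H. H \<in> B \<Longrightarrow> edge_sum (A H) = edges H"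
    by metis
  \<comment> \<open>Generation in coordinates: modulo 2, the expansions of the members of
    \<open>D\<close> add up to \<open>C\<close> alone.\<close>
  have "\<exists>D\<subseteq>B. \<forall>k\<in>?I. odd (card {H \<in> D. k \<in> A H}) \<longleftrightarrow> k = C" if C: "C \<in> ?I" for C
  proof -
    obtain D where D: "D \<subseteq> B" "C = ring_sum D"
      using gen C unfolding generates_cycles_def induced_cycle_def by blast
    have "finite D" using D(1) finB finite_subset by blast
    then have "edge_sum D = edge_sum {k \<in> ?I. odd (card {H \<in> D. k \<in> A H})}"
      using A D(1) finI by (intro edge_sum_of_sums) blast+
    moreover have "edge_sum D = edge_sum {C}" using D(2) by (simp add: ring_sum_eq)
    \<comment> \<open>Independence turns equal edge sums into equal expansions.\<close>
    ultimately have "{k \<in> ?I. odd (card {H \<in> D. k \<in> A H})} = {C}"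
      using C by (intro edge_sum_induced_cycles_inj[OF assms(1,3)]) auto
    with D(1) show ?thesis by (intro exI[of _ D]) blast
  qed
  then obtain f where f: "inj_on f ?I" "f ` ?I \<subseteq> B" "\<forall>C\<in>?I. C \<in> A (f C)"
    using spanning_family_transversal[OF finI finB, of A] by blast
  have "f C = C \<or> card (edges C) < card (edges (f C))" if C: "induced_cycle C G" for C
  proof -
    have fC: "f C \<in> B" "C \<in> A (f C)" using f C by auto
    then have "A (f C) = {C} \<or> card (edges C) < card (edge_sum (A (f C)))"
      using assms(3) A(1) unfolding sums_exceed_summands_def by blast
    moreover have "f C = C" if "A (f C) = {C}"
    proof -
      have "edges (f C) = edges C" using A(2)[OF fC(1)] that by simp
      then show ?thesis
        using eul[OF fC(1)] induced_cycle_eulerian_subgraph[OF C]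
        by (simp add: eulerian_subgraph_def graph.expand)
    qed
    ultimately show ?thesis using A(2)[OF fC(1)] by auto
  qed
  with f(1,2) show ?thesis by (intro that) auto
qed

theorem theorem4:
  fixes G :: "'a graph"
  assumes "polygonal_2_tree G"
  shows "minimum_cycle_basis {C. induced_cycle C G} G \<and>
    (\<forall>B. minimum_cycle_basis B G \<longrightarrow> B = {C. induced_cycle C G})"
proof -
  let ?I = "{C. induced_cycle C G}"
  note simple = polygonal_2_tree_simple_graph[OF assms]
  have span: "spanned_by_induced_cycles G" and exceed: "sums_exceed_summands G"
    using polygonal_2_tree_induced_cycles[OF assms] by auto
  have basis: "cycle_basis ?I G" using induced_cycles_cycle_basis[OF simple span exceed] .
  have finI: "finite ?I" using finite_induced_cycles[OF simple] .
  \<comment> \<open>This dichotomy yields both minimality and uniqueness.\<close>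
  have larger: "B = ?I \<or> total_size ?I < total_size B" if B: "cycle_basis B G" for B
  proof -
    obtain f where f: "inj_on f ?I" "f ` ?I \<subseteq> B"
        "\<And>C. induced_cycle C G \<Longrightarrow> f C = C \<or> card (edges C) < card (edges (f C))"
      using cycle_basis_transversal[OF simple span exceed B] by blast
    show ?thesis
    proof (cases "\<forall>C\<in>?I. f C = C")
      case True
      \<comment> \<open>If \<open>f\<close> fixes every induced cycle, \<open>B\<close> contains
        them all, and a cycle basis has no generating proper subset.\<close>
      then have "?I \<subseteq> B" using f(2) by force
      then show ?thesis
        using B induced_cycles_generate[OF span] unfolding cycle_basis_def by blast
    next
      case False
      have finB: "finite B"
        using B finite_eulerian_subgraphs[OF simple] by (auto simp: cycle_basis_def)
      have "total_size ?I < (\<Sum>C\<in>?I. card (edges (f C)))"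
        unfolding total_size_def
      proof (rule sum_strict_mono_ex1[OF finI])
        show "\<forall>C\<in>?I. card (edges C) \<le> card (edges (f C))"
          using f(3) by (metis less_imp_le mem_Collect_eq order_refl)
        show "\<exists>C\<in>?I. card (edges C) < card (edges (f C))"
          using f(3) False by auto
      qed
      \<comment> \<open>Injectivity of \<open>f\<close> means that each partner in \<open>B\<close>
        is counted only once.\<close>
      also have "\<dots> = total_size (f ` ?I)"
        unfolding total_size_def by (simp add: sum.reindex[OF f(1)])
      also have "\<dots> \<le> total_size B"
        unfolding total_size_def using finB f(2) by (intro sum_mono2) auto
      finally show ?thesis ..
    qed
  qed
  have min: "minimum_cycle_basis ?I G"
    unfolding minimum_cycle_basis_def using basis larger by (metis less_imp_le order_refl)
  moreover have "B = ?I" if "minimum_cycle_basis B G" for B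
    using that larger basis unfolding minimum_cycle_basis_def by (metis not_less)
  ultimately show ?thesis by blast
qed

end
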